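(* Let $q$ be a prime power and let $\mathcal{C}_{q^2-q+1}$ be the plane projective curve defined over $\mathbb{F}_{q^2}$ given by the equation $$X \left( (Y^q+YZ^{q-1})^{q-1}-Z^{q^2-q} \right)+X^{q+1}Z^{q^2-2q}-Y^qZ^{q^2-2q+1}-YZ^{q^2-q}=0.$$ Then $\mathcal{C}_{q^2-q+1}$ is an absolutely irreducible curve of degree $q^2-q+1$ intersecting the Hermitian curve $\mathcal{H}_q$ given by $Y^qZ+YZ^q=X^{q+1}$ in exactly $q^3+1$ distinct $\mathbb{F}_{q^2}$-rational points.
   Context: A plane projective curve defined over $\mathbb{F}_{q^2}$ is given by a nonzero homogeneous polynomial in $X,Y,Z$ with coefficients in $\mathbb{F}_{q^2}$; it is absolutely irreducible if this polynomial is irreducible over an algebraic closure of $\mathbb{F}_{q^2}$.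
   Formalization: Absolute irreducibility is claimed only for q ≠ 2, because for q = 2 the cubic factors as (X+Z)(X+Y)(X+Y+Z); the degree and the intersection statement are proved for all prime powers q. *)

theory Defs
  imports
    "HOL-Computational_Algebra.Computational_Algebra"
    "HOL-Number_Theory.Prime_Powers"
    "HOL-Algebra.Algebraic_Closure_Type"
begin

section \<open>Polynomials in three variables\<close>

text \<open>
  The polynomial ring $K[X,Y,Z]$ is rendered as the iterated ring $K[X][Y][Z]$: the innermost
  indeterminate is $X$ and the outermost one is $Z$.
\<close>

type_synonym 'a poly3 = "'a poly poly poly"

definition var_X :: "'a::comm_ring_1 poly3" where
  "var_X = [:[:[:0, 1:]:]:]"

definition var_Y :: "'a::comm_ring_1 poly3" where
  "var_Y = [:[:0, 1:]:]"

definition var_Z :: "'a::comm_ring_1 poly3" where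
  "var_Z = [:0, 1:]"

text \<open>The coefficient of $X^i Y^j Z^k$.\<close>

definition coeff3 :: "'a::zero poly3 \<Rightarrow> nat \<Rightarrow> nat \<Rightarrow> nat \<Rightarrow> 'a" where
  "coeff3 F i j k = coeff (coeff (coeff F k) j) i"

text \<open>The value $F(x,y,z)$.\<close>

definition eval3 :: "'a::comm_ring_1 poly3 \<Rightarrow> 'a \<Rightarrow> 'a \<Rightarrow> 'a \<Rightarrow> 'a" where
  "eval3 F x y z = poly (poly (poly F [:[:z:]:]) [:y:]) x"

definition homogeneous3 :: "nat \<Rightarrow> 'a::zero poly3 \<Rightarrow> bool" where
  "homogeneous3 d F \<longleftrightarrow> (\<forall>i j k. coeff3 F i j k \<noteq> 0 \<longrightarrow> i + j + k = d)"

text \<open>The total degree; only meaningful for nonzero polynomials.\<close>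

definition total_degree3 :: "'a::zero poly3 \<Rightarrow> nat" where
  "total_degree3 F = Max {i + j + k | i j k. coeff3 F i j k \<noteq> 0}"

definition base_change :: "'a::field poly3 \<Rightarrow> 'a alg_closure poly3" where
  "base_change F = map_poly (map_poly (map_poly to_ac)) F"


section \<open>Plane projective curves\<close>

definition plane_curve :: "'a::field poly3 \<Rightarrow> bool" where
  "plane_curve F \<longleftrightarrow> F \<noteq> 0 \<and> (\<exists>d. homogeneous3 d F)"

definition absolutely_irreducible :: "'a::field poly3 \<Rightarrow> bool" where
  "absolutely_irreducible F \<longleftrightarrow> Factorial_Ring.irreducible (base_change F)"

definition proj_rel :: "(('a::field \<times> 'a \<times> 'a) \<times> ('a \<times> 'a \<times> 'a)) set" where
  "proj_rel = {((x, y, z), (x', y', z')).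
     (x, y, z) \<noteq> (0, 0, 0) \<and> (\<exists>c. c \<noteq> 0 \<and> x' = c * x \<and> y' = c * y \<and> z' = c * z)}"

definition proj_plane :: "('a::field \<times> 'a \<times> 'a) set set" where
  "proj_plane = (UNIV - {(0, 0, 0)}) // proj_rel"

text \<open>
  All points of a curve are geometric points, i.e. points of the projective plane over the
  algebraic closure of the ground field.
\<close>

definition curve_points ::
  "'a::field poly3 \<Rightarrow> ('a alg_closure \<times> 'a alg_closure \<times> 'a alg_closure) set set" where
  "curve_points F = {P \<in> proj_plane. \<forall>(x, y, z) \<in> P. eval3 (base_change F) x y z = 0}"

text \<open>
  A geometric point is rational over the ground field if it has homogeneous coordinates there.
\<close>

definition rational_points ::
  "('a::field alg_closure \<times> 'a alg_closure \<times> 'a alg_closure) set set" where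
  "rational_points = {P \<in> proj_plane. \<exists>a b c. (to_ac a, to_ac b, to_ac c) \<in> P}"


section \<open>The two curves\<close>

definition hermitian_curve :: "nat \<Rightarrow> 'a::comm_ring_1 poly3" where
  "hermitian_curve q = var_Y ^ q * var_Z + var_Y * var_Z ^ q - var_X ^ (q + 1)"

text \<open>For \<open>q \<ge> 2\<close>, no subtraction of natural numbers below is truncated.\<close>

definition curve_C :: "nat \<Rightarrow> 'a::comm_ring_1 poly3" where
  "curve_C q =
     var_X * ((var_Y ^ q + var_Y * var_Z ^ (q - 1)) ^ (q - 1) - var_Z ^ (q\<^sup>2 - q))
     + var_X ^ (q + 1) * var_Z ^ (q\<^sup>2 - 2 * q)
     - var_Y ^ q * var_Z ^ (q\<^sup>2 - 2 * q + 1)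
     - var_Y * var_Z ^ (q\<^sup>2 - q)"

text \<open>
  For \<open>q = 2\<close> the curve is not irreducible: in characteristic two it is the union of
  the three lines $X + Z = 0$, $X + Y = 0$ and $X + Y + Z = 0$.
\<close>

lemma curve_C_2_factorization:
  assumes "(2 :: 'a::comm_ring_1) = 0"
  shows "curve_C 2 = (var_X + var_Z) * (var_X + var_Y) * (var_X + var_Y + var_Z :: 'a poly3)"
proof -
  have "(2 :: 'a poly3) = [:[:[:2:]:]:]"
    by (simp add: numeral_poly)
  hence two: "(2 :: 'a poly3) = 0"
    using assms by simp
  have "(var_X + var_Z) * (var_X + var_Y) * (var_X + var_Y + var_Z) - curve_C 2 =
        2 * (var_X ^ 2 * var_Y + var_X ^ 2 * var_Z + var_X * var_Y * var_Z + var_X * var_Z ^ 2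
             + var_Y ^ 2 * var_Z + var_Y * var_Z ^ 2 :: 'a poly3)"
    by (simp add: curve_C_def algebra_simps power2_eq_square power3_eq_cube)
  with two show ?thesis
    by simp
qed

lemma curve_C_2_not_absolutely_irreducible:
  assumes "(2 :: 'a::field) = 0"
  shows "\<not> absolutely_irreducible (curve_C 2 :: 'a poly3)"
proof
  have two: "(2 :: 'a alg_closure) = 0"
    using assms by (metis to_ac_0 to_ac_numeral)
  have hom: "base_change (curve_C 2 :: 'a poly3) = curve_C 2"
    by (simp add: base_change_def curve_C_def var_X_def var_Y_def var_Z_def map_poly_pCons
          power2_eq_square power3_eq_cube one_pCons)
  assume "absolutely_irreducible (curve_C 2 :: 'a poly3)"
  hence irred: "Factorial_Ring.irreducible ((var_X + var_Z) * ((var_X + var_Y) * (var_X + var_Y + var_Z))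
                  :: 'a alg_closure poly3)"
    by (simp add: absolutely_irreducible_def hom curve_C_2_factorization[OF two] mult.assoc)
  have "\<not> (var_X + var_Z :: 'a alg_closure poly3) dvd 1"
    by (simp add: var_X_def var_Z_def is_unit_poly_iff)
  moreover have "\<not> (var_X + var_Y + var_Z :: 'a alg_closure poly3) dvd 1"
    by (simp add: var_X_def var_Y_def var_Z_def is_unit_poly_iff)
  ultimately show False
    using Factorial_Ring.irreducibleD[OF irred refl] by (meson dvd_mult_right)
qed

end

theory Submission
  imports Defs "HOL-Number_Theory.Residues"
begin

text \<open>
  On the affine Hermitian curve $y^q + y = x^{q+1}$ the equation of $\mathcal{C}_{q^2-q+1}$ reduces to
  $x^{q^2} = x$. Hence $x$, and then by the Frobenius map also $y$, lies in $\mathbb{F}_{q^2}$, and above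
  each of the $q^2$ values of $x$ there are $q$ values of $y$ because $T^q + T - x^{q+1}$ is separable;
  the only common point at infinity is $(0:1:0)$.

  For irreducibility, let $L = K(Z)$ and $w = Y^q + Z^{q-1} Y$, so that the curve becomes
  $f = \alpha X^{q+1} + (w^{q-1} - \beta) X - \gamma w$ over $L[Y]$ with constants $\alpha, \beta, \gamma$.
  Give $X$ weight $q - 1$ and $Y$ weight $1$. The leading form of $f$ is divisible by $X$ but not by
  $X^2$, so in a factorization one factor $a$ has a leading form prime to $X$. As $a(0, Y)$ divides
  $\gamma w$, the weight of $a$ is at most $q$, which for $q \ge 3$ forces $a$ to have degree at most
  one in $X$. A linear factor would give a root $u \in L[Y]$ of degree at least $q - 1$ dividing $w$,
  and comparing degrees in $f(u) = 0$ excludes this. So a factorization over $K$ has a factor in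
  $K[Z]$, and this factor has no root since the curve contains no line $Z = z_0$.
\<close>

section \<open>Factorization of the affine equation\<close>

text \<open>
  The least power of the outer variable occurring in the leading form of \<open>p\<close>, where the outer
  variable has weight \<open>r\<close> and the inner one weight 1.
\<close>

definition dominant_index :: "nat \<Rightarrow> 'a::zero poly poly \<Rightarrow> nat \<Rightarrow> bool" where
  "dominant_index r p i \<longleftrightarrow> coeff p i \<noteq> 0 \<and>
     (\<forall>j. coeff p j \<noteq> 0 \<longrightarrow> degree (coeff p j) + r * j \<le> degree (coeff p i) + r * i \<and>
       (j < i \<longrightarrow> degree (coeff p j) + r * j < degree (coeff p i) + r * i))"

lemma dominant_index_exists:
  assumes "p \<noteq> 0"
  obtains i where "dominant_index r p i"
proof -
  define S where "S = {j. coeff p j \<noteq> 0}"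
  define wt where "wt j = degree (coeff p j) + r * j" for j
  have "S \<subseteq> {..degree p}"
    by (auto simp: S_def le_degree)
  hence fin: "finite S"
    by (rule finite_subset) simp
  have ne: "S \<noteq> {}"
    using assms by (auto simp: S_def poly_eq_iff)
  have "Max (wt ` S) \<in> wt ` S"
    using fin ne by (intro Max_in) auto
  hence ex: "\<exists>j. j \<in> S \<and> wt j = Max (wt ` S)"
    by (metis imageE)
  define i where "i = (LEAST j. j \<in> S \<and> wt j = Max (wt ` S))"
  have i: "i \<in> S" "wt i = Max (wt ` S)"
    using LeastI_ex[OF ex] by (simp_all add: i_def)
  have "wt j \<le> wt i" if "j \<in> S" for j
    using that fin i(2) by simp
  moreover have "wt j \<noteq> wt i" if "j \<in> S" "j < i" for j
    using not_less_Least[of j "\<lambda>j. j \<in> S \<and> wt j = Max (wt ` S)"] that i(2) by (auto simp: i_def)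
  ultimately have "dominant_index r p i"
    using i(1) unfolding dominant_index_def S_def wt_def by (auto intro: le_neq_implies_less)
  thus ?thesis
    by (rule that)
qed

lemma dominant_index_unique:
  assumes "dominant_index r p i" "dominant_index r p j"
  shows "i = j"
  using assms unfolding dominant_index_def by (meson linorder_neqE_nat not_le)

text \<open>Leading forms multiply, and over a domain so do the parts of them of least outer degree,
  hence the indices add.\<close>

lemma dominant_index_mult:
  fixes p q :: "'a::idom poly poly"
  assumes p: "dominant_index r p i" and q: "dominant_index r q k"
  shows "dominant_index r (p * q) (i + k)"
proof -
  define D where "D = degree (coeff p i) + degree (coeff q k)"
  \<comment> \<open>A product of two terms reaches the maximal weight only if both do, and then
    \<open>s \<ge> i\<close> and \<open>t \<ge> k\<close>.\<close>
  have van: "coeff (coeff p s * coeff q t) m = 0"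
    if "D + r * (i + k) \<le> m + r * (s + t)" and st: "s < i \<or> t < k \<or> D + r * (i + k) < m + r * (s + t)"
    for s t m
  proof (cases "coeff p s = 0 \<or> coeff q t = 0")
    case False
    have ps: "degree (coeff p s) + r * s \<le> degree (coeff p i) + r * i"
        "s < i \<Longrightarrow> degree (coeff p s) + r * s < degree (coeff p i) + r * i"
      and qt: "degree (coeff q t) + r * t \<le> degree (coeff q k) + r * k"
        "t < k \<Longrightarrow> degree (coeff q t) + r * t < degree (coeff q k) + r * k"
      using p q False unfolding dominant_index_def by auto
    have "degree (coeff p s * coeff q t) \<le> degree (coeff p s) + degree (coeff q t)"
      by (rule degree_mult_le)
    also have "\<dots> < m"
      using ps qt that unfolding D_def distrib_left by linarith
    finally show ?thesis
      by (rule coeff_eq_0)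
  qed auto
  have le: "degree (coeff (p * q) n) + r * n < D + r * (i + k) \<or>
      (n \<ge> i + k \<and> degree (coeff (p * q) n) + r * n = D + r * (i + k))"
    if nz: "coeff (p * q) n \<noteq> 0" for n
  proof (rule ccontr)
    define m where "m = degree (coeff (p * q) n)"
    assume "\<not> ?thesis"
    hence "D + r * (i + k) \<le> m + r * n" "n < i + k \<or> D + r * (i + k) < m + r * n"
      by (auto simp: m_def)
    hence "coeff (coeff p s * coeff q (n - s)) m = 0" if "s \<le> n" for s
      using that by (intro van) auto
    hence "coeff (coeff (p * q) n) m = 0"
      by (simp add: coeff_mult[of p q n] coeff_sum)
    thus False
      using nz by (simp add: m_def)
  qed
  have "coeff (coeff (p * q) (i + k)) D =
      (\<Sum>s\<le>i + k. coeff (coeff p s * coeff q (i + k - s)) D)"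
    by (simp add: coeff_mult[of p q "i + k"] coeff_sum)
  \<comment> \<open>If \<open>s \<noteq> i\<close>, then \<open>s < i\<close> or
    \<open>i + k - s < k\<close>, so only the product of the two leading coefficients
    survives.\<close>
  also have "\<dots> = (\<Sum>s\<in>{i}. coeff (coeff p s * coeff q (i + k - s)) D)"
  proof (rule sum.mono_neutral_right)
    show "\<forall>s\<in>{..i + k} - {i}. coeff (coeff p s * coeff q (i + k - s)) D = 0"
      by (intro ballI van) auto
  qed auto
  also have "\<dots> = lead_coeff (coeff p i) * lead_coeff (coeff q k)"
    by (simp add: D_def coeff_mult_degree_sum)
  also have "\<dots> \<noteq> 0"
    using p q by (simp add: dominant_index_def)
  finally have top: "coeff (coeff (p * q) (i + k)) D \<noteq> 0" .
  hence "coeff (p * q) (i + k) \<noteq> 0"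
    by auto
  moreover from this top have "degree (coeff (p * q) (i + k)) = D"
    using le[of "i + k"] le_degree[OF top] by auto
  ultimately show ?thesis
    unfolding dominant_index_def using le by force
qed

text \<open>The weight of \<open>a\<close> is attained at its term free of the outer variable X, so
  \<open>(q - 1) * degree a\<close> is at most the degree in Y of a divisor of
  \<open>\<gamma> w\<close>, that is, at most \<open>q\<close>. This leaves a constant, or a linear
  factor with a root \<open>u\<close> in Y, which degrees exclude.\<close>

lemma is_unit_if_dominant_index_0:
  fixes w :: "'a::field poly"
  assumes w: "degree w = q" and q: "q \<ge> 3" and nz: "\<alpha> \<noteq> 0" "\<gamma> \<noteq> 0"
    and f: "monom [:\<alpha>:] (q + 1) + monom (w ^ (q - 1) - [:\<beta>:]) 1 - [:smult \<gamma> w:] = a * b" (is "?f = _")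
    and dom: "dominant_index (q - 1) a 0"
  shows "a dvd 1"
proof -
  define m where "m = degree a"
  have deg_f: "degree ?f = q + 1" and lead: "coeff ?f (q + 1) = [:\<alpha>:]"
  proof -
    show "coeff ?f (q + 1) = [:\<alpha>:]"
      using q by (simp add: coeff_pCons split: nat.splits)
    hence "degree ?f \<ge> q + 1"
      using nz by (intro le_degree) auto
    moreover have "degree ?f \<le> q + 1"
      using q by (intro degree_le) (auto simp: coeff_pCons split: nat.splits)
    ultimately show "degree ?f = q + 1"
      by simp
  qed
  have "?f \<noteq> 0"
    using deg_f by force
  hence ab: "a \<noteq> 0" "b \<noteq> 0"
    using f by auto
  \<comment> \<open>The leading coefficient of the curve in X is free of Y, so the same holds for
    each factor.\<close>
  have "lead_coeff a * lead_coeff b = [:\<alpha>:]"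
    using deg_f lead f by (metis lead_coeff_mult)
  hence "lead_coeff a dvd [:\<alpha>:]"
    by (metis dvdI)
  hence "degree (lead_coeff a) \<le> degree [:\<alpha>:]"
    using nz by (intro dvd_imp_degree_le) auto
  hence "degree (lead_coeff a) = 0"
    by simp
  then obtain c where c: "coeff a m = [:c:]"
    unfolding m_def by (rule degree_eq_zeroE)
  have "c \<noteq> 0"
    using c ab by (auto simp: m_def)
  have "coeff a 0 * coeff b 0 = coeff ?f 0"
    unfolding f by (simp add: coeff_mult)
  also have "\<dots> = smult (- \<gamma>) w"
    by simp
  finally have a0: "coeff a 0 dvd smult (- \<gamma>) w"
    by (metis dvdI)
  have "w \<noteq> 0"
    using w q by auto
  hence deg_a0: "degree (coeff a 0) \<le> q"
    using dvd_imp_degree_le[OF a0] nz w by simp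
  have m_le: "(q - 1) * m \<le> degree (coeff a 0)"
  proof -
    have "degree (coeff a m) + (q - 1) * m \<le> degree (coeff a 0) + (q - 1) * 0"
      using dom c \<open>c \<noteq> 0\<close> unfolding dominant_index_def by (metis pCons_eq_0_iff)
    thus ?thesis
      using c by simp
  qed
  \<comment> \<open>Otherwise \<open>2 * (q - 1) \<le> q\<close>, which is false for
    \<open>q \<ge> 3\<close> but would be an equality for \<open>q = 2\<close>.\<close>
  have "m < 2"
  proof (rule ccontr)
    assume "\<not> m < 2"
    hence "(q - 1) * 2 \<le> (q - 1) * m"
      by (intro mult_left_mono) auto
    thus False
      using m_le deg_a0 q by linarith
  qed
  then consider "m = 0" | "m = 1"
    by linarith
  thus ?thesis
  proof cases
    case 1
    hence "a = [:[:c:]:]"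
      using c by (metis degree_0_id m_def)
    thus ?thesis
      using \<open>c \<noteq> 0\<close> by (simp add: is_unit_const_poly_iff dvd_field_iff)
  next
    case 2
    define h where "h = coeff a 0"
    \<comment> \<open>The root of the linear factor \<open>c X + h\<close>, polynomial in Y because
      \<open>c\<close> is a nonzero constant.\<close>
    define u where "u = smult (- inverse c) h"
    have a: "a = [:h, [:c:]:]"
      by (rule poly_eqI)
         (use 2 c in \<open>auto simp: h_def m_def coeff_pCons coeff_eq_0 split: nat.splits\<close>)
    have deg_u: "degree u \<ge> q - 1"
      using m_le 2 \<open>c \<noteq> 0\<close> by (simp add: u_def h_def)
    have "poly a u = 0"
      using \<open>c \<noteq> 0\<close> by (simp add: a u_def)
    hence "poly ?f u = 0"
      by (simp only: f poly_mult mult_zero_left)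
    hence root: "smult \<alpha> (u ^ (q + 1)) + (w ^ (q - 1) - [:\<beta>:]) * u = smult \<gamma> w"
      by (simp add: poly_monom)
    have "u * (smult \<alpha> (u ^ q) + w ^ (q - 1) - [:\<beta>:]) = smult \<gamma> w"
      using root by (simp add: algebra_simps)
    hence "u dvd smult \<gamma> w"
      by (metis dvdI)
    hence "u dvd w"
      using nz by (simp add: dvd_smult_iff)
    then obtain k where k: "w = u * k"
      by (elim dvdE)
    have "u \<noteq> 0" "k \<noteq> 0"
      using k \<open>w \<noteq> 0\<close> by auto
    hence "degree u + degree k = q"
      using k w degree_mult_eq by metis
    hence deg_k: "degree k \<le> 1"
      using deg_u q by linarith
    obtain s where s: "q = Suc s"
      using q by (cases q) auto
    \<comment> \<open>With \<open>w = u k\<close> both sides of the root equation are divisible by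
      \<open>u\<close>. After cancelling, \<open>u ^ s\<close> divides
      \<open>\<gamma> k + \<beta>\<close>, which has degree at most 1.\<close>
    have "u * (smult \<alpha> (u ^ q) + u ^ s * k ^ s - [:\<beta>:]) = u * smult \<gamma> k"
      using root by (simp add: k s power_mult_distrib algebra_simps)
    hence eq: "smult \<alpha> (u ^ q) + u ^ s * k ^ s - [:\<beta>:] = smult \<gamma> k"
      using \<open>u \<noteq> 0\<close> by (simp del: mult_smult_right)
    hence eq': "u ^ s * (smult \<alpha> u + k ^ s) = smult \<gamma> k + [:\<beta>:]"
      by (simp add: s algebra_simps)
    show ?thesis
    proof (cases "smult \<gamma> k + [:\<beta>:] = 0")
      case False
      have "u ^ s dvd smult \<gamma> k + [:\<beta>:]"
        using eq' by (metis dvdI)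
      hence "degree (u ^ s) \<le> degree (smult \<gamma> k + [:\<beta>:])"
        using False by (rule dvd_imp_degree_le)
      also have "\<dots> \<le> 1"
        using deg_k nz by (intro degree_add_le) auto
      finally have "s * degree u \<le> 1"
        using \<open>u \<noteq> 0\<close> by (simp add: degree_power_eq mult.commute)
      moreover have "s * degree u \<ge> 2 * 2"
        using deg_u s q by (intro mult_mono) auto
      ultimately show ?thesis
        by linarith
    next
      \<comment> \<open>If the right-hand side vanishes, \<open>k\<close> is constant, and then so
        is \<open>u\<close>, a scalar multiple of \<open>k ^ s\<close>.\<close>
      case True
      hence "smult \<alpha> u = - (k ^ s)"
        using eq' \<open>u \<noteq> 0\<close> by (simp add: eq_neg_iff_add_eq_0)
      moreover have "smult \<gamma> k = [:-\<beta>:]"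
        using True by (simp add: eq_neg_iff_add_eq_0[symmetric])
      hence "degree k = 0"
        using nz by (metis degree_pCons_0 degree_smult_eq)
      hence "degree (k ^ s) = 0"
        using \<open>k \<noteq> 0\<close> by (simp add: degree_power_eq)
      ultimately have "degree u = 0"
        using nz by (metis degree_minus degree_smult_eq)
      thus ?thesis
        using deg_u q by simp
    qed
  qed
qed

text \<open>The weight \<open>q - 1\<close> is the one that makes \<open>X ^ (q + 1)\<close> and
  \<open>X w ^ (q - 1)\<close> tie at weight \<open>q\<^sup>2 - 1\<close>, above the weight
  \<open>q\<close> of \<open>w\<close>. The lower of the two powers of X is the first.\<close>

lemma dominant_index_affine_curve:
  fixes w :: "'a::field poly"
  assumes w: "degree w = q" and q: "q \<ge> 2"
  shows "dominant_index (q - 1)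
    (monom [:\<alpha>:] (q + 1) + monom (w ^ (q - 1) - [:\<beta>:]) 1 - [:smult \<gamma> w:]) 1"
    (is "dominant_index _ ?f 1")
proof -
  have "w \<noteq> 0"
    using w q by auto
  have deg: "degree (w ^ (q - 1) - [:\<beta>:]) = q * (q - 1)"
    using w q \<open>w \<noteq> 0\<close> by (subst diff_conv_add_uminus, subst degree_add_eq_left)
      (simp_all add: degree_power_eq mult.commute)
  hence nz: "w ^ (q - 1) - [:\<beta>:] \<noteq> 0"
    using q by force
  have cf: "coeff ?f j = (if j = 0 then - smult \<gamma> w else if j = 1 then w ^ (q - 1) - [:\<beta>:]
      else if j = q + 1 then [:\<alpha>:] else 0)" for j
    using q by (auto simp: coeff_pCons split: nat.splits)
  obtain s where s: "q = s + 2"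
    using q by (metis le_add_diff_inverse2)
  have "degree (smult \<gamma> w) \<le> q"
    using w degree_smult_le[of \<gamma> w] by simp
  thus ?thesis
    unfolding dominant_index_def cf using nz deg by (auto simp: s)
qed

text \<open>The indices of the two factors add up to 1, so one of them is 0.\<close>

lemma affine_curve_factor_unit:
  fixes w :: "'a::field poly"
  assumes w: "degree w = q" and q: "q \<ge> 3" and nz: "\<alpha> \<noteq> 0" "\<gamma> \<noteq> 0"
    and f: "monom [:\<alpha>:] (q + 1) + monom (w ^ (q - 1) - [:\<beta>:]) 1 - [:smult \<gamma> w:] = a * b"
  shows "a dvd 1 \<or> b dvd 1"
proof -
  have dom: "dominant_index (q - 1) (a * b) 1"
    using dominant_index_affine_curve[OF w, of \<alpha> \<beta> \<gamma>] q unfolding f by simp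
  hence "a \<noteq> 0" "b \<noteq> 0"
    by (auto simp: dominant_index_def)
  then obtain i k where ik: "dominant_index (q - 1) a i" "dominant_index (q - 1) b k"
    by (meson dominant_index_exists)
  have "i + k = 1"
    using dominant_index_unique[OF dominant_index_mult[OF ik] dom] .
  then consider "i = 0" | "k = 0"
    by linarith
  thus ?thesis
  proof cases
    case 1
    thus ?thesis
      using is_unit_if_dominant_index_0[OF w q nz f] ik by simp
  next
    case 2
    thus ?thesis
      using is_unit_if_dominant_index_0[OF w q nz, of \<beta> b a] f ik by (simp add: mult.commute)
  qed
qed

section \<open>Ring morphisms and homogeneous polynomials\<close>

text \<open>Evaluation, base change and the passage to K(Z)[Y][X] are all instances, so the image of
  either curve can be read off from the images of the three variables.\<close>

locale ring_morphism =
  fixes h :: "'a::comm_ring_1 \<Rightarrow> 'b::comm_ring_1"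
  assumes add: "h (x + y) = h x + h y"
    and mult: "h (x * y) = h x * h y"
    and one: "h 1 = 1"
begin

lemma zero: "h 0 = 0"
  using add[of 0 0] by simp

lemma diff: "h (x - y) = h x - h y"
  using add[of "x - y" y] by simp

lemma power: "h (x ^ n) = h x ^ n"
  by (induction n) (simp_all add: one mult)

lemma sum: "h (sum g S) = (\<Sum>x\<in>S. h (g x))"
  by (induction S rule: infinite_finite_induct) (simp_all add: zero add)

lemma map_poly: "ring_morphism (map_poly h)"
proof
  show "map_poly h (p + q) = map_poly h p + map_poly h q" for p q
    by (rule poly_eqI) (simp add: coeff_map_poly zero add)
  show "map_poly h (p * q) = map_poly h p * map_poly h q" for p q
    by (rule poly_eqI) (simp add: coeff_map_poly zero coeff_mult sum mult)
  show "map_poly h 1 = 1"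
    by (simp add: one)
qed

text \<open>The universal property of the polynomial ring: \<open>h\<close> extended by sending the
  indeterminate to \<open>x\<close>.\<close>

lemma poly_map_poly: "ring_morphism (\<lambda>p. poly (map_poly h p) x)"
proof -
  interpret m: ring_morphism "map_poly h"
    by (rule map_poly)
  show ?thesis
    by standard (simp_all add: m.add m.mult m.one)
qed


end

lemma ring_morphism_curve_C:
  assumes "ring_morphism h"
  shows "h (curve_C q) = h var_X * ((h var_Y ^ q + h var_Y * h var_Z ^ (q - 1)) ^ (q - 1) - h var_Z ^ (q\<^sup>2 - q))
     + h var_X ^ (q + 1) * h var_Z ^ (q\<^sup>2 - 2 * q)
     - h var_Y ^ q * h var_Z ^ (q\<^sup>2 - 2 * q + 1)
     - h var_Y * h var_Z ^ (q\<^sup>2 - q)"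
proof -
  interpret ring_morphism h by fact
  show ?thesis
    unfolding curve_C_def by (simp only: add mult diff power)
qed

lemma ring_morphism_hermitian_curve:
  assumes "ring_morphism h"
  shows "h (hermitian_curve q) =
    h var_Y ^ q * h var_Z + h var_Y * h var_Z ^ q - h var_X ^ (q + 1)"
proof -
  interpret ring_morphism h by fact
  show ?thesis
    unfolding hermitian_curve_def by (simp only: add mult diff power)
qed

lemma ring_morphism_eval3: "ring_morphism (\<lambda>F. eval3 F x y z)"
  by standard (simp_all add: eval3_def)

lemma eval3_var [simp]:
  "eval3 var_X x y z = x" "eval3 var_Y x y z = y" "eval3 var_Z x y z = z"
  by (simp_all add: eval3_def var_X_def var_Y_def var_Z_def)

lemma ring_morphism_base_change: "ring_morphism (base_change :: 'a::field poly3 \<Rightarrow> _)"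
proof -
  interpret ring_morphism "to_ac :: 'a \<Rightarrow> _"
    by standard simp_all
  interpret ring_morphism "map_poly (to_ac :: 'a \<Rightarrow> _)"
    by (rule map_poly)
  interpret ring_morphism "map_poly (map_poly (to_ac :: 'a \<Rightarrow> _))"
    by (rule map_poly)
  show ?thesis
    unfolding base_change_def [abs_def] by (rule map_poly)
qed

lemma base_change_var [simp]:
  "base_change var_X = var_X" "base_change var_Y = var_Y" "base_change var_Z = var_Z"
  by (simp_all add: base_change_def var_X_def var_Y_def var_Z_def map_poly_pCons)

lemma base_change_curve_C: "base_change (curve_C q) = curve_C q"
  by (subst ring_morphism_curve_C[OF ring_morphism_base_change]) (simp add: curve_C_def)

lemma base_change_hermitian_curve: "base_change (hermitian_curve q) = hermitian_curve q"
  by (subst ring_morphism_hermitian_curve[OF ring_morphism_base_change]) (simp add: hermitian_curve_def)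

lemma eval3_curve_C: "eval3 (curve_C q) x y z =
    x * ((y ^ q + y * z ^ (q - 1)) ^ (q - 1) - z ^ (q\<^sup>2 - q)) + x ^ (q + 1) * z ^ (q\<^sup>2 - 2 * q)
     - y ^ q * z ^ (q\<^sup>2 - 2 * q + 1) - y * z ^ (q\<^sup>2 - q)"
  by (subst ring_morphism_curve_C[OF ring_morphism_eval3]) simp

lemma eval3_hermitian_curve:
  "eval3 (hermitian_curve q) x y z = y ^ q * z + y * z ^ q - x ^ (q + 1)"
  by (subst ring_morphism_hermitian_curve[OF ring_morphism_eval3]) simp

section \<open>Evaluation and homogeneity\<close>

lemma eval3_altdef:
  "eval3 F x y z = (\<Sum>k\<le>degree F. \<Sum>j\<le>degree (coeff F k). \<Sum>i\<le>degree (coeff (coeff F k) j).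
     coeff3 F i j k * x ^ i * y ^ j * z ^ k)"
proof -
  have "eval3 F x y z = (\<Sum>k\<le>degree F. (\<Sum>j\<le>degree (coeff F k).
      (\<Sum>i\<le>degree (coeff (coeff F k) j). coeff3 F i j k * x ^ i) * y ^ j) * z ^ k)"
    unfolding eval3_def coeff3_def
    by (simp only: poly_altdef[of F] poly_altdef[of "coeff F _"] poly_altdef[of "coeff (coeff F _) _"]
        poly_sum poly_mult poly_power poly_pCons poly_0 mult_zero_right add_0_right)
  thus ?thesis
    by (simp only: sum_distrib_right)
qed

lemma eval3_homogeneous:
  assumes "homogeneous3 d F"
  shows "eval3 F (c * x) (c * y) (c * z) = c ^ d * eval3 F x y z"
  unfolding eval3_altdef sum_distrib_left
proof (intro sum.cong refl)
  fix i j k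
  show "coeff3 F i j k * (c * x) ^ i * (c * y) ^ j * (c * z) ^ k =
      c ^ d * (coeff3 F i j k * x ^ i * y ^ j * z ^ k)"
  proof (cases "coeff3 F i j k = 0")
    case False
    hence "d = i + j + k"
      using assms by (simp add: homogeneous3_def)
    thus ?thesis
      by (simp add: power_mult_distrib power_add algebra_simps)
  qed simp
qed

lemma homogeneous3_add:
  fixes F G :: "'a::comm_ring_1 poly3"
  assumes "homogeneous3 d F" "homogeneous3 d G"
  shows "homogeneous3 d (F + G)"
  unfolding homogeneous3_def
proof (intro allI impI)
  fix i j k
  assume "coeff3 (F + G) i j k \<noteq> 0"
  hence "coeff3 F i j k \<noteq> 0 \<or> coeff3 G i j k \<noteq> 0"
    by (auto simp: coeff3_def)
  thus "i + j + k = d"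
    using assms by (auto simp: homogeneous3_def)
qed

lemma homogeneous3_diff:
  fixes F G :: "'a::comm_ring_1 poly3"
  assumes "homogeneous3 d F" "homogeneous3 d G"
  shows "homogeneous3 d (F - G)"
  unfolding homogeneous3_def
proof (intro allI impI)
  fix i j k
  assume "coeff3 (F - G) i j k \<noteq> 0"
  hence "coeff3 F i j k \<noteq> 0 \<or> coeff3 G i j k \<noteq> 0"
    by (auto simp: coeff3_def)
  thus "i + j + k = d"
    using assms by (auto simp: homogeneous3_def)
qed

lemma homogeneous3_mult:
  fixes F G :: "'a::comm_ring_1 poly3"
  assumes F: "homogeneous3 d F" and G: "homogeneous3 e G"
  shows "homogeneous3 (d + e) (F * G)"
  unfolding homogeneous3_def
proof (intro allI impI)
  fix i j k
  assume "coeff3 (F * G) i j k \<noteq> 0"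
  hence "(\<Sum>c\<le>k. \<Sum>b\<le>j. \<Sum>a\<le>i. coeff3 F a b c * coeff3 G (i - a) (j - b) (k - c)) \<noteq> 0"
    by (simp add: coeff3_def coeff_mult coeff_sum)
  then obtain a b c where abc: "a \<le> i" "b \<le> j" "c \<le> k"
      "coeff3 F a b c * coeff3 G (i - a) (j - b) (k - c) \<noteq> 0"
    by (metis (no_types, lifting) sum.neutral atMost_iff)
  hence "coeff3 F a b c \<noteq> 0" "coeff3 G (i - a) (j - b) (k - c) \<noteq> 0"
    by auto
  hence "a + b + c = d" "(i - a) + (j - b) + (k - c) = e"
    using F G unfolding homogeneous3_def by auto
  thus "i + j + k = d + e"
    using abc by linarith
qed

lemma homogeneous3_var:
  "homogeneous3 1 (var_X :: 'a::comm_ring_1 poly3)"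
  "homogeneous3 1 (var_Y :: 'a::comm_ring_1 poly3)"
  "homogeneous3 1 (var_Z :: 'a::comm_ring_1 poly3)"
  by (auto simp: homogeneous3_def coeff3_def var_X_def var_Y_def var_Z_def coeff_pCons
      one_pCons split: nat.splits)

lemma homogeneous3_1: "homogeneous3 0 (1 :: 'a::comm_ring_1 poly3)"
  by (auto simp: homogeneous3_def coeff3_def coeff_1 split: if_splits)

lemma homogeneous3_power:
  "homogeneous3 d (F :: 'a::comm_ring_1 poly3) \<Longrightarrow> homogeneous3 (d * n) (F ^ n)"
  by (induction n) (simp_all add: homogeneous3_1 homogeneous3_mult)

lemma homogeneous3_var_power:
  "homogeneous3 n (var_X ^ n :: 'a::comm_ring_1 poly3)"
  "homogeneous3 n (var_Y ^ n :: 'a::comm_ring_1 poly3)"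
  "homogeneous3 n (var_Z ^ n :: 'a::comm_ring_1 poly3)"
  using homogeneous3_power[OF homogeneous3_var(1), of n] homogeneous3_power[OF homogeneous3_var(2), of n]
    homogeneous3_power[OF homogeneous3_var(3), of n] by simp_all

lemma total_degree3_homogeneous:
  assumes "homogeneous3 d F" "F \<noteq> 0"
  shows "total_degree3 F = d"
proof -
  obtain i j k where "coeff3 F i j k \<noteq> 0"
    using assms(2) by (auto simp: coeff3_def poly_eq_iff)
  hence "{i + j + k | i j k. coeff3 F i j k \<noteq> 0} = {d}"
    using assms(1) unfolding homogeneous3_def by fastforce
  thus ?thesis
    by (simp add: total_degree3_def)
qed

lemma homogeneous3_curve_C:
  assumes "q \<ge> 2"
  shows "homogeneous3 (q\<^sup>2 - q + 1) (curve_C q :: 'a::comm_ring_1 poly3)"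
proof -
  \<comment> \<open>Writing \<open>q = s + 2\<close> turns the truncated subtractions in the
    exponents into ordinary arithmetic.\<close>
  obtain s where s: "q = s + 2"
    using assms by (metis le_add_diff_inverse2)
  have exps: "q\<^sup>2 - q = q * (q - 1)" "1 + (q\<^sup>2 - q) = q\<^sup>2 - q + 1"
    "q + 1 + (q\<^sup>2 - 2 * q) = q\<^sup>2 - q + 1" "q + (q\<^sup>2 - 2 * q + 1) = q\<^sup>2 - q + 1"
    by (simp_all add: s power2_eq_square algebra_simps)
  have "homogeneous3 (1 + (q - 1)) (var_Y * var_Z ^ (q - 1) :: 'a poly3)"
    by (rule homogeneous3_mult[OF homogeneous3_var(2) homogeneous3_var_power(3)])
  hence "homogeneous3 q (var_Y * var_Z ^ (q - 1) :: 'a poly3)"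
    using assms by simp
  hence "homogeneous3 q (var_Y ^ q + var_Y * var_Z ^ (q - 1) :: 'a poly3)"
    by (rule homogeneous3_add[OF homogeneous3_var_power(2)])
  hence "homogeneous3 (q\<^sup>2 - q) ((var_Y ^ q + var_Y * var_Z ^ (q - 1)) ^ (q - 1) :: 'a poly3)"
    unfolding exps(1) by (rule homogeneous3_power)
  note homogeneous3_mult[OF homogeneous3_var(1) homogeneous3_diff[OF this homogeneous3_var_power(3)]]
    and homogeneous3_mult[OF homogeneous3_var_power(1)[of "q + 1"] homogeneous3_var_power(3)[of "q\<^sup>2 - 2 * q"]]
    and homogeneous3_mult[OF homogeneous3_var_power(2)[of q] homogeneous3_var_power(3)[of "q\<^sup>2 - 2 * q + 1"]]
    and homogeneous3_mult[OF homogeneous3_var(2) homogeneous3_var_power(3)[of "q\<^sup>2 - q"]]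
  note this[unfolded exps(2-4)]
  thus ?thesis
    unfolding curve_C_def by (blast intro: homogeneous3_add homogeneous3_diff)
qed

lemma homogeneous3_hermitian_curve:
  "homogeneous3 (q + 1) (hermitian_curve q :: 'a::comm_ring_1 poly3)"
proof -
  have "homogeneous3 (1 + q) (var_Y * var_Z ^ q :: 'a poly3)"
    by (intro homogeneous3_mult homogeneous3_var homogeneous3_var_power)
  hence "homogeneous3 (q + 1) (var_Y * var_Z ^ q :: 'a poly3)"
    by simp
  thus ?thesis
    unfolding hermitian_curve_def
    using homogeneous3_mult[OF homogeneous3_var_power(2)[of q] homogeneous3_var(3)]
      homogeneous3_var_power(1)[of "q + 1"]
    by (intro homogeneous3_add homogeneous3_diff) simp_all
qed

section \<open>Irreducibility\<close>

text \<open>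
  The embedding of $K[X][Y][Z]$ into $K(Z)[Y][X]$, in which the order of the indeterminates is reversed.
\<close>

definition affine_over_fract :: "'a::field poly3 \<Rightarrow> 'a poly fract poly poly" where
  "affine_over_fract F =
     poly (map_poly (\<lambda>P. poly (map_poly (map_poly (\<lambda>c. [:to_fract [:c:]:])) P) [:[:0, 1:]:]) F)
       [:[:to_fract [:0, 1:]:]:]"

lemma ring_morphism_affine_over_fract:
  "ring_morphism (affine_over_fract :: 'a::field poly3 \<Rightarrow> _)"
proof -
  interpret c: ring_morphism "\<lambda>c :: 'a. [:to_fract [:c:]:]"
  proof
    fix x y :: 'a
    have "[:x * y:] = [:x:] * [:y:]" "[:x + y:] = [:x:] + [:y:]"
      by simp_all
    thus "[:to_fract [:x * y:]:] = [:to_fract [:x:]:] * [:to_fract [:y:]:]"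
      "[:to_fract [:x + y:]:] = [:to_fract [:x:]:] + [:to_fract [:y:]:]"
      by (simp_all only: to_fract_mult to_fract_add) simp_all
  qed (simp flip: one_pCons)
  interpret X: ring_morphism "map_poly (\<lambda>c :: 'a. [:to_fract [:c:]:])"
    by (rule c.map_poly)
  interpret Y: ring_morphism "\<lambda>P. poly (map_poly (map_poly (\<lambda>c :: 'a. [:to_fract [:c:]:])) P) [:[:0, 1:]:]"
    by (rule X.poly_map_poly)
  show ?thesis
    unfolding affine_over_fract_def [abs_def] by (rule Y.poly_map_poly)
qed

lemma affine_over_fract_var:
  "affine_over_fract var_X = [:0, 1:]"
  "affine_over_fract var_Y = [:[:0, 1:]:]"
  "affine_over_fract var_Z = [:[:to_fract [:0, 1:]:]:]"
  by (simp_all add: affine_over_fract_def var_X_def var_Y_def var_Z_def map_poly_pCons one_pCons[symmetric])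

text \<open>The coefficient of \<open>X^i Y^j\<close> collects the powers of Z into one polynomial,
  so nothing is lost in passing to K(Z).\<close>

lemma coeff_affine_over_fract:
  "coeff (coeff (affine_over_fract F) i) j = to_fract (\<Sum>k\<le>degree F. monom (coeff3 F i j k) k)"
proof -
  let ?c = "\<lambda>c :: 'a. [:to_fract [:c:]:]"
  let ?Y = "\<lambda>P. poly (map_poly (map_poly ?c) P) [:[:0, 1:]:]"
  have Y: "coeff (coeff (?Y P) i) j = to_fract [:coeff (coeff P j) i:]" for P
  proof -
    have "coeff (?Y P) i = (\<Sum>l\<le>degree (map_poly (map_poly ?c) P).
        [:to_fract [:coeff (coeff P l) i:]:] * [:0, 1:] ^ l)"
      by (simp add: poly_altdef coeff_sum coeff_map_poly poly_const_pow mult.commute)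
    also have "coeff \<dots> j = (\<Sum>l\<le>degree (map_poly (map_poly ?c) P).
        if l = j then to_fract [:coeff (coeff P l) i:] else 0)"
      unfolding coeff_sum
      by (intro sum.cong refl) (simp flip: monom_altdef)
    also have "\<dots> = to_fract [:coeff (coeff P j) i:]"
    \<comment> \<open>Beyond the degree the sum has no term for \<open>j\<close>, and the
      coefficient of \<open>P\<close> there is zero as well.\<close>
    proof (cases "j \<le> degree (map_poly (map_poly ?c) P)")
      case False
      hence "coeff (map_poly (map_poly ?c) P) j = 0"
        by (simp add: coeff_eq_0)
      hence "map_poly ?c (coeff P j) = 0"
        by (simp add: coeff_map_poly)
      hence "coeff (map_poly ?c (coeff P j)) i = 0"
        by simp
      thus ?thesis
        using False by (simp add: coeff_map_poly)
    qed simp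
    finally show ?thesis .
  qed
  have deg: "degree (map_poly ?Y F) \<le> degree F"
    by (rule map_poly_degree_leq)
  have "affine_over_fract F = (\<Sum>k\<le>degree (map_poly ?Y F).
      ?Y (coeff F k) * [:[:to_fract [:0, 1:] ^ k:]:])"
    by (simp add: affine_over_fract_def poly_altdef[of "map_poly ?Y F"] coeff_map_poly poly_const_pow)
  also have "\<dots> = (\<Sum>k\<le>degree F. ?Y (coeff F k) * [:[:to_fract [:0, 1:] ^ k:]:])"
  proof (rule sum.mono_neutral_left)
    show "\<forall>k\<in>{..degree F} - {..degree (map_poly ?Y F)}. ?Y (coeff F k) * [:[:to_fract [:0, 1:] ^ k:]:] = 0"
    proof
      fix k
      assume "k \<in> {..degree F} - {..degree (map_poly ?Y F)}"
      hence "coeff (map_poly ?Y F) k = 0"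
        by (intro coeff_eq_0) auto
      thus "?Y (coeff F k) * [:[:to_fract [:0, 1:] ^ k:]:] = 0"
        by (simp add: coeff_map_poly)
    qed
  qed (use deg in auto)
  finally have "coeff (coeff (affine_over_fract F) i) j =
      (\<Sum>k\<le>degree F. to_fract [:coeff3 F i j k:] * to_fract [:0, 1:] ^ k)"
    by (simp add: coeff_sum Y coeff3_def mult.commute)
  also have "\<dots> = to_fract (\<Sum>k\<le>degree F. [:coeff3 F i j k:] * [:0, 1:] ^ k)"
  proof -
    interpret ring_morphism "to_fract :: 'a poly \<Rightarrow> _"
      by standard simp_all
    show ?thesis
      by (simp only: sum mult power)
  qed
  also have "\<dots> = to_fract (\<Sum>k\<le>degree F. monom (coeff3 F i j k) k)"
    by (simp add: monom_altdef)
  finally show ?thesis .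
qed

text \<open>Injectivity of the embedding, coefficient by coefficient: \<open>to_fract\<close> is
  injective and distinct powers of Z do not mix.\<close>

lemma coeff3_eq_0_if_affine_over_fract:
  assumes "coeff (coeff (affine_over_fract F) i) j = 0"
  shows "coeff3 F i j k = 0"
proof (cases "k \<le> degree F")
  case True
  have "(\<Sum>l\<le>degree F. monom (coeff3 F i j l) l) = 0"
    using assms by (simp only: coeff_affine_over_fract to_fract_eq_0_iff)
  hence "coeff (\<Sum>l\<le>degree F. monom (coeff3 F i j l) l) k = 0"
    by simp
  thus ?thesis
    using True by (simp add: coeff_sum)
next
  case False
  thus ?thesis
    by (simp add: coeff3_def coeff_eq_0)
qed

text \<open>Thanks to this identity the last two terms of the curve combine to a multiple of
  \<open>Y^q + Z^(q-1) Y\<close>.\<close>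

lemma power_exponent_split:
  fixes z :: "'a::comm_monoid_mult"
  assumes "q \<ge> 2"
  shows "z ^ (q\<^sup>2 - q) = z ^ (q\<^sup>2 - 2 * q + 1) * z ^ (q - 1)"
proof -
  obtain s where "q = s + 2"
    using assms by (metis le_add_diff_inverse2)
  hence "q\<^sup>2 - q = (q\<^sup>2 - 2 * q + 1) + (q - 1)"
    by (simp add: power2_eq_square algebra_simps)
  thus ?thesis
    by (simp only: power_add)
qed

text \<open>This identifies the constants of the affine equation: \<alpha>, \<beta>, \<gamma> are
  the powers of Z with exponents \<open>q\<^sup>2 - 2 * q\<close>, \<open>q\<^sup>2 - q\<close>,
  \<open>q\<^sup>2 - 2 * q + 1\<close>; for \<open>q \<ge> 2\<close> all are units of K(Z).\<close>

lemma affine_over_fract_curve_C: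
  fixes q :: nat
  defines "Z \<equiv> to_fract [:0, 1 :: 'a::field:]"
  assumes q: "q \<ge> 2"
  shows "affine_over_fract (curve_C q :: 'a poly3) =
    monom [:Z ^ (q\<^sup>2 - 2 * q):] (q + 1)
    + monom ((monom 1 q + smult (Z ^ (q - 1)) [:0, 1:]) ^ (q - 1) - [:Z ^ (q\<^sup>2 - q):]) 1
    - [:smult (Z ^ (q\<^sup>2 - 2 * q + 1)) (monom 1 q + smult (Z ^ (q - 1)) [:0, 1:]):]"
proof -
  have Z: "Z ^ (q\<^sup>2 - q) = Z ^ (q\<^sup>2 - 2 * q + 1) * Z ^ (q - 1)"
    using q by (rule power_exponent_split)
  define w where "w = monom 1 q + smult (Z ^ (q - 1)) [:0, 1:]"
  have w: "[:[:0, 1:]:] ^ q + [:[:0, 1:]:] * [:[:Z:]:] ^ (q - 1) = [:w:]"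
    by (simp add: w_def poly_const_pow monom_altdef)
  have "affine_over_fract (curve_C q :: 'a poly3) =
      [:0, 1:] * ([:w:] ^ (q - 1) - [:[:Z:]:] ^ (q\<^sup>2 - q)) + [:0, 1:] ^ (q + 1) * [:[:Z:]:] ^ (q\<^sup>2 - 2 * q)
      - ([:[:0, 1:]:] ^ q * [:[:Z:]:] ^ (q\<^sup>2 - 2 * q + 1) + [:[:0, 1:]:] * [:[:Z:]:] ^ (q\<^sup>2 - q))"
    by (simp only: ring_morphism_curve_C[OF ring_morphism_affine_over_fract] affine_over_fract_var
        Z_def[symmetric] w diff_diff_eq)
  also have "[:[:0, 1:]:] ^ q * [:[:Z:]:] ^ (q\<^sup>2 - 2 * q + 1) + [:[:0, 1:]:] * [:[:Z:]:] ^ (q\<^sup>2 - q)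
      = [:smult (Z ^ (q\<^sup>2 - 2 * q + 1)) w:]"
    unfolding poly_const_pow Z
    by (simp add: w_def monom_altdef smult_add_right)
  also have "[:0, 1:] * ([:w:] ^ (q - 1) - [:[:Z:]:] ^ (q\<^sup>2 - q)) = monom (w ^ (q - 1) - [:Z ^ (q\<^sup>2 - q):]) 1"
    by (simp add: poly_const_pow monom_altdef)
  also have "[:0, 1:] ^ (q + 1) * [:[:Z:]:] ^ (q\<^sup>2 - 2 * q) = monom [:Z ^ (q\<^sup>2 - 2 * q):] (q + 1)"
    by (simp add: poly_const_pow monom_altdef)
  finally show ?thesis
    unfolding w_def by (simp add: algebra_simps)
qed

text \<open>A unit of K(Z)[Y][X] lies in K(Z), so \<open>G\<close> is a polynomial \<open>g\<close>
  in Z alone. If \<open>g\<close> were not constant, it would have a root \<open>z\<close>, and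
  \<open>G\<close> would vanish for all \<open>x\<close>, \<open>y\<close> at this
  \<open>z\<close>.\<close>

lemma unit_if_affine_over_fract_unit:
  fixes G :: "'a::alg_closed_field poly3"
  assumes unit: "affine_over_fract G dvd 1"
    and nz: "\<And>z. \<exists>x y. eval3 G x y z \<noteq> 0"
  shows "G dvd 1"
proof -
  define g where "g = map_poly (\<lambda>P. coeff (coeff P 0) 0) G"
  obtain p where p: "affine_over_fract G = [:p:]" "p dvd 1"
    using unit by (auto simp: is_unit_poly_iff)
  then obtain c where "affine_over_fract G = [:[:c:]:]"
    by (auto simp: is_unit_poly_iff)
  hence z: "coeff3 G i j k = 0" if "i \<noteq> 0 \<or> j \<noteq> 0" for i j k
    using that by (intro coeff3_eq_0_if_affine_over_fract) (auto simp: coeff_pCons split: nat.splits)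
  have G: "coeff G k = [:[:coeff g k:]:]" for k
    by (intro poly_eqI)
      (use z in \<open>auto simp: g_def coeff_map_poly coeff3_def coeff_pCons split: nat.splits\<close>)
  have G_map: "G = map_poly (\<lambda>c. [:[:c:]:]) g"
    by (rule poly_eqI) (simp add: G coeff_map_poly)
  have eval: "eval3 G x y z = poly g z" for x y z
  proof -
    have "poly G [:[:z:]:] = [:[:poly g z:]:]"
      unfolding G_map by (induction g) (simp_all add: map_poly_pCons)
    thus ?thesis
      by (simp add: eval3_def)
  qed
  have "degree g = 0"
    using alg_closed_imp_poly_has_root[of g] nz eval by (metis gr0I)
  then obtain c where c: "g = [:c:]"
    by (rule degree_eq_zeroE)
  hence "c \<noteq> 0"
    using nz[of 0] eval by auto
  moreover have "G = [:[:[:c:]:]:]"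
    unfolding G_map c by (simp add: map_poly_pCons)
  ultimately show ?thesis
    by (simp add: is_unit_const_poly_iff dvd_field_iff)
qed

text \<open>This shows that the curve contains no line \<open>Z = z\<close>. At \<open>z = 0\<close>
  the point (1:1:0) is a witness; for other \<open>z\<close> one takes \<open>x = 0\<close> and
  solves \<open>y^q + z^(q-1) y = 1\<close>, which leaves minus a power of \<open>z\<close>.\<close>

lemma eval3_curve_C_nonzero:
  fixes z :: "'a::alg_closed_field"
  assumes q: "q \<ge> 2" and z: "z = 0 \<Longrightarrow> q \<noteq> 2"
  shows "\<exists>x y. eval3 (curve_C q) x y z \<noteq> 0"
proof (cases "z = 0")
  case True
  \<comment> \<open>Positive exponents are needed because \<open>0 ^ 0 = 1\<close>.\<close>
  have "q\<^sup>2 - 2 * q > 0" "q\<^sup>2 - q > 0"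
    using q z True by (auto simp: power2_eq_square)
  hence "eval3 (curve_C q) 1 1 z \<noteq> 0"
    using True q by (simp add: eval3_curve_C power_0_left)
  thus ?thesis
    by blast
next
  case False
  define p where "p = monom 1 q + [:- 1, z ^ (q - 1):]"
  have "degree p = q"
    unfolding p_def using q by (subst degree_add_eq_left) (simp_all add: degree_monom_eq)
  then obtain y where "poly p y = 0"
    using alg_closed_imp_poly_has_root[of p] q by auto
  hence y: "y ^ q + y * z ^ (q - 1) = 1"
    by (simp add: p_def poly_monom algebra_simps)
  have "z ^ (q\<^sup>2 - q) = z ^ (q\<^sup>2 - 2 * q + 1) * z ^ (q - 1)"
    using q by (rule power_exponent_split)
  hence "eval3 (curve_C q) 0 y z = - ((y ^ q + y * z ^ (q - 1)) * z ^ (q\<^sup>2 - 2 * q + 1))"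
    by (simp add: eval3_curve_C algebra_simps)
  thus ?thesis
    using y False by (intro exI[of _ 0] exI[of _ y]) simp
qed

text \<open>A factorization is carried to K(Z)[Y][X], where one image is a unit. Both factors
  inherit from the product that they vanish on no line \<open>Z = z\<close>, so the unit
  descends.\<close>

lemma irreducible_curve_C:
  assumes q: "q \<ge> 3"
  shows "Factorial_Ring.irreducible (curve_C q :: 'a::alg_closed_field poly3)"
proof (rule Factorial_Ring.irreducibleI)
  interpret \<rho>: ring_morphism "affine_over_fract :: 'a poly3 \<Rightarrow> _"
    by (rule ring_morphism_affine_over_fract)
  have nz: "\<exists>x y. eval3 (curve_C q) x y z \<noteq> 0" for z :: 'a
    using q by (intro eval3_curve_C_nonzero) auto
  show "curve_C q \<noteq> (0 :: 'a poly3)"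
    using nz by (auto simp: eval3_def)
  show "\<not> curve_C q dvd (1 :: 'a poly3)"
  proof
    assume "curve_C q dvd (1 :: 'a poly3)"
    then obtain H :: "'a poly3" where "1 = curve_C q * H"
      by (elim dvdE)
    \<comment> \<open>The equation vanishes at the origin, which a divisor of 1 cannot do.\<close>
    hence "eval3 1 0 0 0 = eval3 (curve_C q) 0 0 (0 :: 'a) * eval3 H 0 0 0"
      using ring_morphism.mult[OF ring_morphism_eval3, of "curve_C q" H 0 0 0] by simp
    moreover have "eval3 (curve_C q) 0 0 (0 :: 'a) = 0"
      using q by (simp add: eval3_curve_C)
    ultimately show False
      by (simp add: eval3_def)
  qed
  fix G H :: "'a poly3"
  assume GH: "curve_C q = G * H"
  have nzG: "\<exists>x y. eval3 G x y z \<noteq> 0" and nzH: "\<exists>x y. eval3 H x y z \<noteq> 0" for z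
    using nz[of z] unfolding GH ring_morphism.mult[OF ring_morphism_eval3]
    by (metis mult_zero_left, metis mult_zero_right)
  define Z :: "'a poly fract" where "Z = to_fract [:0, 1:]"
  have "Z \<noteq> 0"
    by (simp add: Z_def)
  have "affine_over_fract G dvd 1 \<or> affine_over_fract H dvd 1"
  proof (rule affine_curve_factor_unit[OF _ q])
    show "monom [:Z ^ (q\<^sup>2 - 2 * q):] (q + 1)
      + monom ((monom 1 q + smult (Z ^ (q - 1)) [:0, 1:]) ^ (q - 1) - [:Z ^ (q\<^sup>2 - q):]) 1
      - [:smult (Z ^ (q\<^sup>2 - 2 * q + 1)) (monom 1 q + smult (Z ^ (q - 1)) [:0, 1:]):]
      = affine_over_fract G * affine_over_fract H"
      unfolding Z_def \<rho>.mult[symmetric] GH[symmetric]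
      by (rule affine_over_fract_curve_C[symmetric]) (use q in simp)
    show "degree (monom 1 q + smult (Z ^ (q - 1)) [:0, 1:]) = q"
      using q by (subst degree_add_eq_left) (simp_all add: degree_monom_eq)
  qed (use \<open>Z \<noteq> 0\<close> in auto)
  thus "G dvd 1 \<or> H dvd 1"
    using unit_if_affine_over_fract_unit nzG nzH by blast
qed

section \<open>Intersection with the Hermitian curve\<close>

text \<open>The polynomial splits into \<open>degree p\<close> linear factors, and a repeated one
  would give a common root with the derivative.\<close>

lemma card_roots_separable:
  fixes p :: "'a::alg_closed_field poly"
  assumes "p \<noteq> 0" and sep: "\<And>x. poly p x = 0 \<Longrightarrow> poly (pderiv p) x \<noteq> 0"
  shows "card {x. poly p x = 0} = degree p"
proof -
  obtain A where A: "size A = degree p" "p = smult (lead_coeff p) (\<Prod>x\<in>#A. [:-x, 1:])"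
    using alg_closed_imp_factorization[OF assms(1)] by blast
  have roots: "{x. poly p x = 0} = set_mset A"
    by (subst A(2)) (use assms(1) in \<open>auto simp: poly_prod_mset prod_mset_zero_iff\<close>)
  have "count A x = 1" if "x \<in># A" for x
  proof (rule ccontr)
    assume "count A x \<noteq> 1"
    with that have "x \<in># A - {#x#}"
      by (simp add: count_greater_zero_iff[symmetric] del: count_greater_zero_iff)
    with that obtain B where "A = {#x, x#} + B"
      by (metis add_mset_add_single insert_DiffM union_mset_add_mset_left add_mset_commute empty_neutral(1))
    hence "p = [:-x, 1:] * ([:-x, 1:] * smult (lead_coeff p) (\<Prod>y\<in>#B. [:-y, 1:]))"
      using A(2) by simp
    then obtain r where r: "p = [:-x, 1:] * ([:-x, 1:] * r)"
      by blast
    have "poly p x = 0" "poly (pderiv p) x = 0"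
      unfolding r pderiv_mult poly_add by (simp_all only: poly_mult) simp_all
    thus False
      using sep by blast
  qed
  hence "(\<Sum>x\<in>set_mset A. count A x) = card (set_mset A)"
    by simp
  thus ?thesis
    using A(1) roots by (simp add: size_multiset_overloaded_eq)
qed

text \<open>Multiplication by a nonzero \<open>x\<close> permutes the nonzero elements; comparing
  their products gives the claim.\<close>

lemma finite_field_power_card:
  fixes x :: "'f::{field,finite}"
  shows "x ^ card (UNIV :: 'f set) = x"
proof (cases "x = 0")
  case True
  thus ?thesis
    by (simp add: card_gt_0_iff)
next
  case False
  have "(\<Prod>y\<in>-{0}. x * y) = \<Prod>(-{0})"
    by (rule prod.reindex_bij_witness[of _ "\<lambda>y. y / x" "\<lambda>y. x * y"]) (use False in auto)
  hence "x ^ card (-{0} :: 'f set) * \<Prod>(-{0}) = \<Prod>(-{0})"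
    by (simp add: prod.distrib)
  hence "x ^ card (-{0} :: 'f set) = 1"
    by simp
  moreover have "card (UNIV :: 'f set) = Suc (card (-{0} :: 'f set))"
    by (metis Compl_eq_Diff_UNIV UNIV_I card.remove finite)
  ultimately show ?thesis
    by simp
qed

section \<open>Points of the projective plane and of curves\<close>

lemma proj_rel_class_iff:
  "(x', y', z') \<in> proj_rel `` {(x, y, z)} \<longleftrightarrow>
    (x, y, z) \<noteq> (0, 0, 0) \<and> (\<exists>c. c \<noteq> 0 \<and> x' = c * x \<and> y' = c * y \<and> z' = c * z)"
  by (auto simp: proj_rel_def)

lemma proj_rel_class_scale:
  assumes "c \<noteq> 0"
  shows "proj_rel `` {(c * x, c * y, c * z)} = proj_rel `` {(x, y, z)}"
proof -
  have "(\<exists>d. d \<noteq> 0 \<and> x' = d * (c * x) \<and> y' = d * (c * y) \<and> z' = d * (c * z)) \<longleftrightarrow>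
      (\<exists>d. d \<noteq> 0 \<and> x' = d * x \<and> y' = d * y \<and> z' = d * z)" (is "?l \<longleftrightarrow> ?r") for x' y' z'
  proof
    assume ?l
    then obtain d where "d \<noteq> 0" "x' = d * (c * x)" "y' = d * (c * y)" "z' = d * (c * z)"
      by blast
    thus ?r
      using assms by (intro exI[of _ "d * c"]) simp
  next
    assume ?r
    then obtain d where "d \<noteq> 0" "x' = d * x" "y' = d * y" "z' = d * z"
      by blast
    thus ?l
      using assms by (intro exI[of _ "d / c"]) simp
  qed
  moreover have "(c * x, c * y, c * z) = (0, 0, 0) \<longleftrightarrow> (x, y, z) = (0, 0, 0)"
    using assms by simp
  ultimately have "p \<in> proj_rel `` {(c * x, c * y, c * z)} \<longleftrightarrow> p \<in> proj_rel `` {(x, y, z)}" for p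
    by (cases p) (simp only: proj_rel_class_iff)
  thus ?thesis
    by blast
qed

lemma proj_rel_class_self: "(x, y, z) \<noteq> (0, 0, 0) \<Longrightarrow> (x, y, z) \<in> proj_rel `` {(x, y, z)}"
  unfolding proj_rel_class_iff by (intro conjI exI[of _ 1]) simp_all

lemma in_proj_plane_iff:
  "P \<in> proj_plane \<longleftrightarrow> (\<exists>x y z. (x, y, z) \<noteq> (0, 0, 0) \<and> P = proj_rel `` {(x, y, z)})"
  by (auto simp: proj_plane_def quotient_def)

text \<open>Homogeneity makes vanishing independent of the representative, so one representative
  suffices.\<close>

lemma class_in_curve_points_iff:
  assumes hom: "homogeneous3 d (base_change F)" and nz: "(x, y, z) \<noteq> (0, 0, 0)"
  shows "proj_rel `` {(x, y, z)} \<in> curve_points F \<longleftrightarrow> eval3 (base_change F) x y z = 0"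
proof
  assume "proj_rel `` {(x, y, z)} \<in> curve_points F"
  hence "\<forall>(x, y, z)\<in>proj_rel `` {(x, y, z)}. eval3 (base_change F) x y z = 0"
    by (simp add: curve_points_def)
  from bspec[OF this proj_rel_class_self[OF nz]] show "eval3 (base_change F) x y z = 0"
    by simp
next
  assume "eval3 (base_change F) x y z = 0"
  hence "eval3 (base_change F) x' y' z' = 0" if "(x', y', z') \<in> proj_rel `` {(x, y, z)}" for x' y' z'
    using that by (auto simp: proj_rel_def eval3_homogeneous[OF hom])
  moreover have "proj_rel `` {(x, y, z)} \<in> proj_plane"
    using nz in_proj_plane_iff by blast
  ultimately show "proj_rel `` {(x, y, z)} \<in> curve_points F"
    by (auto simp: curve_points_def)
qed

text \<open>The common points in the chart \<open>z = 1\<close>, fibred over \<open>x\<close>. The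
  condition \<open>x ^ q\<^sup>2 = x\<close> stands in for the equation of the first curve.\<close>

definition affine_intersection :: "nat \<Rightarrow> ('a::field \<times> 'a) set" where
  "affine_intersection q = (SIGMA x:{x. x ^ q\<^sup>2 = x}. {y. y ^ q + y = x ^ (q + 1)})"

text \<open>Substituting \<open>x ^ (q + 1)\<close> for \<open>y ^ q + y\<close> cancels the last
  terms, and \<open>(q + 1) * (q - 1) + 1 = q\<^sup>2\<close> gives the exponent of the
  first.\<close>

lemma eval3_on_affine_hermitian_curve:
  assumes q: "q \<ge> 2" and y: "y ^ q + y = x ^ (q + 1)"
  shows "eval3 (curve_C q) x y 1 = x ^ q\<^sup>2 - x"
proof -
  have "(q + 1) * (q - 1) + 1 = q\<^sup>2"
    using q by (cases q) (auto simp: power2_eq_square algebra_simps)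
  hence "x ^ q\<^sup>2 = x ^ ((q + 1) * (q - 1)) * x"
    by (metis power_add power_one_right)
  hence "x * (x ^ (q + 1)) ^ (q - 1) = x ^ q\<^sup>2"
    unfolding power_mult by (simp only: mult.commute)
  moreover have "eval3 (curve_C q) x y 1 = x * (y ^ q + y) ^ (q - 1) - x + x ^ (q + 1) - (y ^ q + y)"
    by (simp add: eval3_curve_C algebra_simps)
  ultimately show ?thesis
    unfolding y by simp
qed

text \<open>At infinity the Hermitian equation becomes \<open>x ^ (q + 1) = 0\<close>, which leaves
  only (0:1:0). Every other point is scaled to \<open>z = 1\<close>.\<close>

lemma curve_points_intersection:
  assumes q: "q \<ge> 2"
  shows "curve_points (curve_C q :: 'f::field poly3) \<inter> curve_points (hermitian_curve q) =
    insert (proj_rel `` {(0, 1, 0)}) ((\<lambda>(x, y). proj_rel `` {(x, y, 1)}) ` affine_intersection q)"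
    (is "?I = insert ?P (?p ` _)")
proof -
  have on_C: "proj_rel `` {(x, y, z)} \<in> curve_points (curve_C q :: 'f poly3) \<longleftrightarrow>
      eval3 (curve_C q) x y z = 0" if "(x, y, z) \<noteq> (0, 0, 0)" for x y z
    using class_in_curve_points_iff[OF _ that, of "q\<^sup>2 - q + 1" "curve_C q :: 'f poly3"]
    unfolding base_change_curve_C using homogeneous3_curve_C[OF q] by blast
  have on_H: "proj_rel `` {(x, y, z)} \<in> curve_points (hermitian_curve q :: 'f poly3) \<longleftrightarrow>
      eval3 (hermitian_curve q) x y z = 0" if "(x, y, z) \<noteq> (0, 0, 0)" for x y z
    using class_in_curve_points_iff[OF _ that, of "q + 1" "hermitian_curve q :: 'f poly3"]
    unfolding base_change_hermitian_curve using homogeneous3_hermitian_curve by blast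
  have affine: "?p (x, y) \<in> ?I \<longleftrightarrow> (x, y) \<in> affine_intersection q" for x y
    using eval3_on_affine_hermitian_curve[OF q, of y x]
    by (auto simp: on_C on_H eval3_hermitian_curve affine_intersection_def)
  have "q\<^sup>2 - q > 0"
    using q by (simp add: power2_eq_square)
  hence "?P \<in> ?I"
    using q by (simp add: on_C on_H eval3_curve_C eval3_hermitian_curve)
  moreover have "P \<in> insert ?P (?p ` affine_intersection q)" if "P \<in> ?I" for P
  proof -
    have "P \<in> proj_plane"
      using that by (simp add: curve_points_def)
    then obtain x y z where nz: "(x, y, z) \<noteq> (0, 0, 0)" and P: "P = proj_rel `` {(x, y, z)}"
      using in_proj_plane_iff by blast
    show ?thesis
    proof (cases "z = 0")
      case True
      have "eval3 (hermitian_curve q) x y z = 0"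
        using that on_H[OF nz] P by simp
      hence "x = 0"
        using True q by (simp add: eval3_hermitian_curve power_0_left)
      thus ?thesis
        using P nz True proj_rel_class_scale[of y 0 1 0] by simp
    next
      case False
      hence "P = ?p (x / z, y / z)"
        using P proj_rel_class_scale[of z "x / z" "y / z" 1] by simp
      thus ?thesis
        using affine[of "x / z" "y / z"] that by blast
    qed
  qed
  moreover have "?p s \<in> ?I" if "s \<in> affine_intersection q" for s
    using affine[of "fst s" "snd s"] that by (simp only: prod.collapse)
  ultimately show ?thesis
    by blast
qed

lemma card_curve_points_intersection:
  assumes q: "q \<ge> 2" and fin: "finite (affine_intersection q :: ('f::field alg_closure \<times> _) set)"
  shows "card (curve_points (curve_C q :: 'f poly3) \<inter> curve_points (hermitian_curve q)) =
    card (affine_intersection q :: ('f alg_closure \<times> _) set) + 1"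
proof -
  let ?p = "\<lambda>(x, y). proj_rel `` {(x :: 'f alg_closure, y, 1)}"
  have inj: "inj_on ?p (affine_intersection q)"
  proof (rule inj_onI, clarify)
    fix x y x' y' :: "'f alg_closure"
    assume "proj_rel `` {(x, y, 1)} = proj_rel `` {(x', y', 1)}"
    hence "(x, y, 1) \<in> proj_rel `` {(x', y', 1)}"
      using proj_rel_class_self[of x y 1] by auto
    thus "x = x' \<and> y = y'"
      by (auto simp: proj_rel_def)
  qed
  have "proj_rel `` {(0 :: 'f alg_closure, 1, 0)} \<noteq> proj_rel `` {(x, y, 1)}" for x y
  proof
    assume "proj_rel `` {(0 :: 'f alg_closure, 1, 0)} = proj_rel `` {(x, y, 1)}"
    hence "(x, y, 1) \<in> proj_rel `` {(0, 1, 0)}"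
      using proj_rel_class_self[of x y 1] by simp
    thus False
      by (auto simp: proj_rel_def)
  qed
  hence "proj_rel `` {(0 :: 'f alg_closure, 1, 0)} \<notin> ?p ` affine_intersection q"
    by auto
  thus ?thesis
    using fin by (simp add: curve_points_intersection[OF q] card_image[OF inj])
qed

section \<open>Rationality and the point count over the field with \<open>q\<^sup>2\<close>
  elements\<close>

context
  fixes q :: nat
  assumes primepow: "primepow q" and card_f: "card (UNIV :: 'f::{field,finite} set) = q\<^sup>2"
begin

text \<open>The characteristic divides the order \<open>q\<^sup>2\<close> of the field, hence is the
  prime of which \<open>q\<close> is a power.\<close>

lemma CHAR_primepow:
  obtains k where "Factorial_Ring.prime CHAR('f)" "k > 0" "q = CHAR('f) ^ k"
proof -
  obtain p k where pk: "Factorial_Ring.prime p" "k > 0" "q = p ^ k"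
    using primepow by (auto simp: primepow_def)
  have prime: "Factorial_Ring.prime CHAR('f)"
    using finite_imp_CHAR_pos prime_CHAR_semidom by (metis finite_UNIV)
  have "CHAR('f) dvd q\<^sup>2"
    using CHAR_dvd_CARD[where ?'a = 'f] card_f by simp
  hence "CHAR('f) dvd p"
    using prime pk by (metis prime_dvd_power)
  hence "CHAR('f) = p"
    using prime pk primes_dvd_imp_eq by blast
  thus ?thesis
    using that pk prime by blast
qed

lemma of_nat_q: "of_nat q = (0 :: 'f alg_closure)"
proof -
  obtain k where "k > 0" "q = CHAR('f) ^ k"
    using CHAR_primepow by blast
  thus ?thesis
    by (simp add: of_nat_eq_0_iff_char_dvd)
qed

lemma frobenius_add: "(x + y :: 'f alg_closure) ^ q = x ^ q + y ^ q"
proof -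
  obtain k where "Factorial_Ring.prime CHAR('f)" "q = CHAR('f) ^ k"
    using CHAR_primepow by blast
  thus ?thesis
    by (intro freshmans_dream'[of q k]) simp_all
qed

text \<open>As \<open>q = 0\<close> in the field, \<open>T^(q^2) - T\<close> has derivative -1 and
  no repeated roots.\<close>

lemma card_fixed: "card {x :: 'f alg_closure. x ^ q\<^sup>2 = x} = q\<^sup>2"
proof -
  define p :: "'f alg_closure poly" where "p = monom 1 (q\<^sup>2) + [:0, -1:]"
  have "q\<^sup>2 > 1"
    using primepow_gt_Suc_0[OF primepow] one_less_power[of q 2] by simp
  hence deg: "degree p = q\<^sup>2"
    unfolding p_def by (subst degree_add_eq_left) (simp_all add: degree_monom_eq)
  have "card {x. poly p x = 0} = degree p"
  proof (rule card_roots_separable)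
    show "p \<noteq> 0"
      using deg \<open>q\<^sup>2 > 1\<close> by auto
    show "poly (pderiv p) x \<noteq> 0" for x
      by (simp add: p_def pderiv_add pderiv_monom of_nat_q pderiv_pCons poly_monom)
  qed
  thus ?thesis
    using deg by (simp add: p_def poly_monom)
qed

text \<open>The derivative of \<open>T^q + T - t\<close> is 1.\<close>

lemma card_hermitian_fibre: "card {y :: 'f alg_closure. y ^ q + y = t} = q"
proof -
  define p :: "'f alg_closure poly" where "p = monom 1 q + [:- t, 1:]"
  have "q > 1"
    using primepow_gt_Suc_0[OF primepow] by simp
  hence deg: "degree p = q"
    unfolding p_def by (subst degree_add_eq_left) (simp_all add: degree_monom_eq)
  have "card {x. poly p x = 0} = degree p"
  proof (rule card_roots_separable)
    show "p \<noteq> 0"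
      using deg \<open>q > 1\<close> by auto
    show "poly (pderiv p) x \<noteq> 0" for x
      by (simp add: p_def pderiv_add pderiv_monom of_nat_q pderiv_pCons poly_monom)
  qed
  thus ?thesis
    using deg by (simp add: p_def poly_monom algebra_simps)
qed

text \<open>All elements of the ground field satisfy the equation, and both sets have
  \<open>q\<^sup>2\<close> elements. This is the test for rationality.\<close>

lemma fixed_eq_range: "{x :: 'f alg_closure. x ^ q\<^sup>2 = x} = range to_ac"
proof (rule card_subset_eq[symmetric])
  show "finite {x :: 'f alg_closure. x ^ q\<^sup>2 = x}"
    using card_fixed primepow_gt_Suc_0[OF primepow] by (intro card_ge_0_finite) simp
  show "range to_ac \<subseteq> {x :: 'f alg_closure. x ^ q\<^sup>2 = x}"
    using finite_field_power_card[where ?'f = 'f] card_f by (auto simp flip: to_ac_power)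
  show "card (range (to_ac :: 'f \<Rightarrow> _)) = card {x :: 'f alg_closure. x ^ q\<^sup>2 = x}"
    by (simp add: card_image[OF inj_to_ac] card_fixed card_f)
qed

lemma affine_intersection_rational:
  assumes "(x :: 'f alg_closure, y) \<in> affine_intersection q"
  shows "x \<in> range to_ac" "y \<in> range to_ac"
proof -
  have x: "x ^ q\<^sup>2 = x" and y: "y ^ q + y = x ^ (q + 1)"
    using assms by (auto simp: affine_intersection_def)
  show "x \<in> range to_ac"
    using x fixed_eq_range by auto
  \<comment> \<open>Raising the Hermitian equation to the power \<open>q\<close> leaves its
    right-hand side unchanged, since \<open>x ^ q\<^sup>2 = x\<close>; then \<open>y ^ q\<close>
    cancels.\<close>
  have "y ^ q\<^sup>2 + y ^ q = (y ^ q + y) ^ q"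
    by (simp add: frobenius_add power2_eq_square power_mult)
  also have "\<dots> = x ^ q\<^sup>2 * x ^ q"
    unfolding y power_mult[symmetric] power_add[symmetric] by (simp add: power2_eq_square add.commute)
  also have "\<dots> = y ^ q + y"
    using x y by simp
  finally have "y ^ q\<^sup>2 = y"
    by simp
  thus "y \<in> range to_ac"
    using fixed_eq_range by auto
qed

lemma card_affine_intersection:
  "finite (affine_intersection q :: ('f alg_closure \<times> _) set)"
  "card (affine_intersection q :: ('f alg_closure \<times> _) set) = q ^ 3"
proof -
  have "q > 0"
    using primepow_gt_0_nat[OF primepow] .
  have fin1: "finite {x :: 'f alg_closure. x ^ q\<^sup>2 = x}"
    using card_fixed \<open>q > 0\<close> by (intro card_ge_0_finite) simp
  have fin2: "finite {y :: 'f alg_closure. y ^ q + y = t}" for t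
    using card_hermitian_fibre \<open>q > 0\<close> by (intro card_ge_0_finite) simp
  show "finite (affine_intersection q :: ('f alg_closure \<times> _) set)"
    unfolding affine_intersection_def using fin1 fin2 by (intro finite_SigmaI)
  have "card (affine_intersection q :: ('f alg_closure \<times> _) set) = q\<^sup>2 * q"
    unfolding affine_intersection_def
    by (subst card_SigmaI) (simp_all only: fin1 fin2 card_hermitian_fibre card_fixed sum_constant ball_simps simp_thms of_nat_id)
  thus "card (affine_intersection q :: ('f alg_closure \<times> _) set) = q ^ 3"
    by (simp add: power2_eq_square power3_eq_cube)
qed

lemma curve_points_intersection_rational:
  "curve_points (curve_C q :: 'f poly3) \<inter> curve_points (hermitian_curve q) \<subseteq> rational_points"
proof -
  have q: "q \<ge> 2"
    using primepow_gt_Suc_0[OF primepow] by simp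
  have rat: "proj_rel `` {(to_ac a, to_ac b, to_ac c)} \<in> rational_points"
    if "(to_ac a, to_ac b, to_ac c) \<noteq> (0, 0, 0)" for a b c :: 'f
    unfolding rational_points_def using that in_proj_plane_iff proj_rel_class_self[OF that] by blast
  have "proj_rel `` {(0 :: 'f alg_closure, 1, 0)} \<in> rational_points"
    using rat[of 0 1 0] by simp
  moreover have "proj_rel `` {(x :: 'f alg_closure, y, 1)} \<in> rational_points"
    if xy: "(x, y) \<in> affine_intersection q" for x y
  proof -
    obtain a b where "x = to_ac a" "y = to_ac b"
      using affine_intersection_rational[OF xy] by blast
    thus ?thesis
      using rat[of a b 1] by simp
  qed
  ultimately show ?thesis
    unfolding curve_points_intersection[OF q] by auto
qed

end

theorem theorem2p2:
  fixes q :: nat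
  assumes "primepow q"
    and "card (UNIV :: 'f::{field,finite} set) = q\<^sup>2"
  shows "plane_curve (curve_C q :: 'f poly3) \<and>
    total_degree3 (curve_C q :: 'f poly3) = q\<^sup>2 - q + 1 \<and>
    (q \<noteq> 2 \<longrightarrow> absolutely_irreducible (curve_C q :: 'f poly3)) \<and>
    curve_points (curve_C q :: 'f poly3) \<inter> curve_points (hermitian_curve q) \<subseteq> rational_points \<and>
    card (curve_points (curve_C q :: 'f poly3) \<inter> curve_points (hermitian_curve q)) = q ^ 3 + 1"
proof (intro conjI impI)
  have q: "q \<ge> 2"
    using primepow_gt_Suc_0[OF assms(1)] by simp
  have hom: "homogeneous3 (q\<^sup>2 - q + 1) (curve_C q :: 'f poly3)"
    by (rule homogeneous3_curve_C[OF q])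
  \<comment> \<open>The choice \<open>z = 1\<close> covers \<open>q = 2\<close> as well.\<close>
  obtain x y where "eval3 (base_change (curve_C q :: 'f poly3)) x y 1 \<noteq> 0"
    using eval3_curve_C_nonzero[OF q, of "1 :: 'f alg_closure"] by (auto simp: base_change_curve_C)
  hence nz: "curve_C q \<noteq> (0 :: 'f poly3)"
    by (auto simp: base_change_def eval3_def)
  show "plane_curve (curve_C q :: 'f poly3)"
    using nz hom by (auto simp: plane_curve_def)
  show "total_degree3 (curve_C q :: 'f poly3) = q\<^sup>2 - q + 1"
    by (rule total_degree3_homogeneous[OF hom nz])
  show "absolutely_irreducible (curve_C q :: 'f poly3)" if "q \<noteq> 2"
    using irreducible_curve_C[of q] that q
    by (simp add: absolutely_irreducible_def base_change_curve_C)
  show "curve_points (curve_C q :: 'f poly3) \<inter> curve_points (hermitian_curve q) \<subseteq> rational_points"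
    by (rule curve_points_intersection_rational[OF assms])
  show "card (curve_points (curve_C q :: 'f poly3) \<inter> curve_points (hermitian_curve q)) = q ^ 3 + 1"
    using card_curve_points_intersection[OF q card_affine_intersection(1)[OF assms]]
    by (simp only: card_affine_intersection(2)[OF assms])
qed

end
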